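(* The mapping $H:\mathbb{R}^n\rightrightarrows\mathbb{R}^n$, $H(u)=Au-l+Q(u)$, arising from the discretized static contact problem with Coulomb friction (defined in the context), is semismooth$^{*}$ at each point of its graph.
   Context: Data: integers $p\ge1$ and $n\ge3p$, a positive definite matrix $A\in\mathbb{R}^{n\times n}$ (stiffness matrix), a vector $l\in\mathbb{R}^n$, and a friction coefficient $\mathcal{F}>0$. Vectors $u\in\mathbb{R}^n$ are partitioned as $u=(u^1,\dots,u^p,u^R)$ with $u^i\in\mathbb{R}^3$, $u^R\in\mathbb{R}^{n-3p}$. For $v=(v_1,v_2,v_3)\in\mathbb{R}^3$ write $v_{12}=(v_1,v_2)\in\mathbb{R}^2$. Let $$Q(u)=\prod_{i=1}^p\tilde Q(u^i)\times Q^R(u^R),\qquad \tilde Q(v)=\left\{\begin{pmatrix}-\mathcal{F}\vartheta\,\partial\|v_{12}\|\\ \vartheta\end{pmatrix}\ \Big|\ \vartheta\in N_{\mathbb{R}_+}(v_3)\right\},\qquad Q^R(v)=\{0\},$$ where $\partial\|\cdot\|$ is the convex subdifferential of the Euclidean norm on $\mathbb{R}^2$ and $N_{\mathbb{R}_+}$ is the normal cone mapping of $\mathbb{R}_+=[0,\infty)$ (with $N_{\mathbb{R}_+}(t)=\emptyset$ for $t<0$). Thus $(g,\vartheta)\in\tilde Q(v)$ iff $\vartheta\in N_{\mathbb{R}_+}(v_3)$ and $g\in-\mathcal{F}\vartheta\,\partial\|v_{12}\|$. For a mapping $F:\mathbb{R}^n\rightrightarrows\mathbb{R}^n$ with closed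 graph $\mathrm{gph}\,F=\{(x,y): y\in F(x)\}$, the limiting coderivative $D^*F(x,y)$ at $(x,y)\in\mathrm{gph}\,F$ is given by $\mathrm{gph}\,D^*F(x,y)=\{(y^*,x^* ): (x^*,-y^* )\in N_{\mathrm{gph}\,F}(x,y)\}$, where $N$ is the limiting (Mordukhovich) normal cone. $F$ is semismooth$^*$ at $(\bar x,\bar y)\in\mathrm{gph}\,F$ if for every $\epsilon>0$ there is $\delta>0$ such that $|\langle x^*,x-\bar x\rangle-\langle y^*,y-\bar y\rangle|\le\epsilon\|(x,y)-(\bar x,\bar y)\|\,\|(x^*,y^* )\|$ for all $(x,y)\in\mathrm{gph}\,F$ with $\|(x,y)-(\bar x,\bar y)\|\le\delta$ and all $(y^*,x^* )\in\mathrm{gph}\,D^*F(x,y)$. *)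

theory Defs
  imports "HOL-Analysis.Analysis"
begin

text \<open>Convex and variational analysis. Set-valued mappings are functions into sets.\<close>

definition graph_of :: "('a \<Rightarrow> 'b set) \<Rightarrow> ('a \<times> 'b) set" where
  "graph_of F = {(x, y). y \<in> F x}"

definition subdifferential :: "('a::real_inner \<Rightarrow> real) \<Rightarrow> 'a \<Rightarrow> 'a set" where
  "subdifferential f x = {s. \<forall>y. f y \<ge> f x + s \<bullet> (y - x)}"

definition convex_normal_cone :: "'a::real_inner set \<Rightarrow> 'a \<Rightarrow> 'a set" where
  "convex_normal_cone C x = (if x \<in> C then {z. \<forall>y\<in>C. z \<bullet> (y - x) \<le> 0} else {})"

definition tangent_cone :: "'a::real_inner set \<Rightarrow> 'a \<Rightarrow> 'a set" where
  "tangent_cone \<Omega> x = {d. \<exists>(t :: nat \<Rightarrow> real) (w :: nat \<Rightarrow> 'a).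
      (\<forall>k. t k > 0) \<and> t \<longlonglongrightarrow> 0 \<and> w \<longlonglongrightarrow> d \<and> (\<forall>k. x + t k *\<^sub>R w k \<in> \<Omega>)}"

definition regular_normal_cone :: "'a::real_inner set \<Rightarrow> 'a \<Rightarrow> 'a set" where
  "regular_normal_cone \<Omega> x = {z. \<forall>d\<in>tangent_cone \<Omega> x. z \<bullet> d \<le> 0}"

definition limiting_normal_cone :: "'a::real_inner set \<Rightarrow> 'a \<Rightarrow> 'a set" where
  "limiting_normal_cone \<Omega> x = {z. \<exists>(\<xi> :: nat \<Rightarrow> 'a) (\<zeta> :: nat \<Rightarrow> 'a).
      (\<forall>k. \<xi> k \<in> \<Omega>) \<and> \<xi> \<longlonglongrightarrow> x \<and> \<zeta> \<longlonglongrightarrow> z \<and> (\<forall>k. \<zeta> k \<in> regular_normal_cone \<Omega> (\<xi> k))}"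

definition limiting_coderivative ::
    "('a::real_inner \<Rightarrow> 'b::real_inner set) \<Rightarrow> 'a \<Rightarrow> 'b \<Rightarrow> 'b \<Rightarrow> 'a set" where
  "limiting_coderivative F x y ys = {xs. (xs, - ys) \<in> limiting_normal_cone (graph_of F) (x, y)}"

text \<open>The notion is meaningful only for mappings with closed graph and at points of the graph;
  both requirements are part of the definition.\<close>

definition semismooth_star_at ::
    "('a::real_inner \<Rightarrow> 'b::real_inner set) \<Rightarrow> 'a \<Rightarrow> 'b \<Rightarrow> bool" where
  "semismooth_star_at F xb yb \<longleftrightarrow>
     closed (graph_of F) \<and> (xb, yb) \<in> graph_of F \<and>
     (\<forall>\<epsilon>>0. \<exists>\<delta>>0. \<forall>(x, y) \<in> graph_of F. norm ((x, y) - (xb, yb)) \<le> \<delta> \<longrightarrow>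
        (\<forall>(ys, xs) \<in> graph_of (limiting_coderivative F x y).
           \<bar>xs \<bullet> (x - xb) - ys \<bullet> (y - yb)\<bar> \<le> \<epsilon> * norm ((x, y) - (xb, yb)) * norm (xs, ys)))"

text \<open>No symmetry is required of a positive definite matrix.\<close>

definition positive_definite :: "real^'n^'n \<Rightarrow> bool" where
  "positive_definite A \<longleftrightarrow> (\<forall>x. x \<noteq> 0 \<longrightarrow> x \<bullet> (A *v x) > 0)"

text \<open>The contact mapping. The index type \<open>'n\<close> carries no order, so a bijection \<open>e\<close> from
  \<open>{1..CARD('n)}\<close> to it names the coordinates: \<open>u $ e j\<close> is the \<open>j\<close>-th component of \<open>u\<close>.
  The blocks \<open>u\<^sup>1, \<dots>, u\<^sup>p\<close> are numbered from 1, and \<open>u\<^sup>R\<close> consists of the components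
  with number above \<open>3 * p\<close>.\<close>

definition tang :: "real^3 \<Rightarrow> real^2" where
  "tang v = vector [v $ 1, v $ 2]"

definition Q_tilde :: "real \<Rightarrow> real^3 \<Rightarrow> (real^3) set" where
  "Q_tilde \<F> v = {vector [g $ 1, g $ 2, \<theta>] | g \<theta>.
      \<theta> \<in> convex_normal_cone {0..} (v $ 3) \<and>
      g \<in> (\<lambda>s. - (\<F> * \<theta>) *\<^sub>R s) ` subdifferential norm (tang v)}"

definition block :: "(nat \<Rightarrow> 'n) \<Rightarrow> nat \<Rightarrow> real^'n \<Rightarrow> real^3" where
  "block e i u = vector [u $ e (3 * i - 2), u $ e (3 * i - 1), u $ e (3 * i)]"

definition Q_map :: "(nat \<Rightarrow> 'n) \<Rightarrow> nat \<Rightarrow> real \<Rightarrow> real^'n \<Rightarrow> (real^'n) set" where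
  "Q_map e p \<F> u = {q. (\<forall>i\<in>{1..p}. block e i q \<in> Q_tilde \<F> (block e i u)) \<and>
                       (\<forall>j\<in>{3 * p + 1..CARD('n)}. q $ e j = 0)}"

definition H_map ::
    "(nat \<Rightarrow> 'n) \<Rightarrow> nat \<Rightarrow> real \<Rightarrow> real^'n^'n \<Rightarrow> real^'n \<Rightarrow> real^'n \<Rightarrow> (real^'n) set" where
  "H_map e p \<F> A l u = {A *v u - l + q | q. q \<in> Q_map e p \<F> u}"

end

theory Submission
  imports Defs
begin

text \<open>
  The defining inequality is stable under limits of normals, so it suffices to bound
  \<open>z \<bullet> (x - xb)\<close> for regular normals \<open>z\<close> to the graph at \<open>x\<close>. This quantity is small as soon as
  both \<open>x - xb\<close> and its negative are, up to \<open>o(norm (x - xb))\<close>, tangent to the graph at \<open>x\<close>. Regular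
  normals of a union are regular normals of each piece containing the point, and regular normals
      of the
  graph of \<open>H\<close> restrict, through the adjoints of linear embeddings, to regular normals of the
      graphs of
  the blocks. So the property has to be checked only for the pieces of the graph of \<open>Q_tilde\<close>: no
  contact and stick are locally conical, and slip is a smooth image of \<open>(s, r, \<omega>)\<close> with \<open>\<omega>\<close> on the
      unit
  sphere, namely \<open>(s *\<^sub>R \<omega>, r *\<^sub>R \<omega>, r)\<close>.
\<close>

section \<open>Semismooth* sets\<close>

text \<open>Regular normals are antitone in the set, limiting ones are not; this is what makes
  unions tractable. \<open>xb\<close> may lie outside \<open>S\<close>, so a union can be treated
  piece by piece, and \<open>x = xb\<close> is left out because both sides vanish there.\<close>

definition semismooth_star_set :: "'a::real_inner set \<Rightarrow> 'a \<Rightarrow> bool" where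
  "semismooth_star_set S xb \<longleftrightarrow> (\<forall>\<epsilon>>0. \<forall>\<^sub>F x in at xb within S.
     \<forall>z\<in>regular_normal_cone S x. \<bar>z \<bullet> (x - xb)\<bar> \<le> \<epsilon> * norm (x - xb) * norm z)"

lemma semismooth_star_at_if_set:
  assumes "closed (graph_of F)" "(xb, yb) \<in> graph_of F"
    and S: "semismooth_star_set (graph_of F) (xb, yb)"
  shows "semismooth_star_at F xb yb"
  unfolding semismooth_star_at_def
proof (intro conjI assms(1,2) allI impI)
  fix \<epsilon> :: real assume "\<epsilon> > 0"
  then obtain d where d: "d > 0" and *: "\<And>p z. p \<in> graph_of F \<Longrightarrow> p \<noteq> (xb, yb) \<Longrightarrow> dist p (xb, yb) < d \<Longrightarrow>
      z \<in> regular_normal_cone (graph_of F) p \<Longrightarrow> \<bar>z \<bullet> (p - (xb, yb))\<bar>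
          \<le> \<epsilon> * norm (p - (xb, yb)) * norm z"
    using S unfolding semismooth_star_set_def eventually_at by blast
  have "\<bar>xs \<bullet> (x - xb) - ys \<bullet> (y - yb)\<bar> \<le> \<epsilon> * norm ((x, y) - (xb, yb)) * norm (xs, ys)"
    if near: "norm ((x, y) - (xb, yb)) \<le> d / 2"
      and cod: "xs \<in> limiting_coderivative F x y ys" for x y xs ys
  proof -
    obtain \<xi> \<zeta> where \<xi>: "\<And>k. \<xi> k \<in> graph_of F" "\<xi> \<longlonglongrightarrow> (x, y)"
      and \<zeta>: "\<zeta> \<longlonglongrightarrow> (xs, - ys)" "\<And>k. \<zeta> k \<in> regular_normal_cone (graph_of F) (\<xi> k)"
      using cod unfolding limiting_coderivative_def limiting_normal_cone_def by blast
    \<comment> \<open>The halved radius puts \<open>(x, y)\<close> strictly inside the ball of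
      radius \<open>d\<close>, so the approximating points \<open>\<xi> k\<close> eventually lie in
      it as well.\<close>
    have "dist (x, y) (xb, yb) < d"
      using near d by (simp add: dist_norm)
    then have "\<forall>\<^sub>F k in sequentially. dist (\<xi> k) (xb, yb) < d"
      by (intro order_tendstoD[OF tendsto_dist[OF \<xi>(2) tendsto_const]])
    then have "\<forall>\<^sub>F k in sequentially.
        \<bar>\<zeta> k \<bullet> (\<xi> k - (xb, yb))\<bar> \<le> \<epsilon> * norm (\<xi> k - (xb, yb)) * norm (\<zeta> k)"
    proof eventually_elim
      case (elim k)
      show ?case
      proof (cases "\<xi> k = (xb, yb)")
        case False
        then show ?thesis by (rule *[OF \<xi>(1) _ elim \<zeta>(2)])
      qed simp
    qed
    then have "\<bar>(xs, - ys) \<bullet> ((x, y) - (xb, yb))\<bar> \<le> \<epsilon> * norm ((x, y) - (xb, yb)) * norm (xs, - ys)"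
      by (rule tendsto_le[OF sequentially_bot, rotated 2]) (intro tendsto_intros \<xi> \<zeta>)+
    then show ?thesis
      by (simp add: norm_Pair)
  qed
  then show "\<exists>\<delta>>0. \<forall>(x, y)\<in>graph_of F. norm ((x, y) - (xb, yb)) \<le> \<delta> \<longrightarrow>
      (\<forall>(ys, xs)\<in>graph_of (limiting_coderivative F x y).
         \<bar>xs \<bullet> (x - xb) - ys \<bullet> (y - yb)\<bar> \<le> \<epsilon> * norm ((x, y) - (xb, yb)) * norm (xs, ys))"
    using d unfolding graph_of_def by (intro exI[of _ "d / 2"] conjI ballI) (clarsimp, simp)
qed

section \<open>Monotonicity of the cones and unions of sets\<close>

lemma tangent_cone_mono: "S \<subseteq> T \<Longrightarrow> tangent_cone S x \<subseteq> tangent_cone T x"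
  unfolding tangent_cone_def by blast

lemma regular_normal_cone_antimono: "S \<subseteq> T \<Longrightarrow> regular_normal_cone T x \<subseteq> regular_normal_cone S x"
  unfolding regular_normal_cone_def using tangent_cone_mono by blast

lemma semismooth_star_set_Un:
  assumes "semismooth_star_set S xb" "semismooth_star_set T xb"
  shows "semismooth_star_set (S \<union> T) xb"
  unfolding semismooth_star_set_def
proof (intro allI impI)
  fix \<epsilon> :: real assume e: "\<epsilon> > 0"
  let ?P = "\<lambda>S x. \<forall>z\<in>regular_normal_cone S x. \<bar>z \<bullet> (x - xb)\<bar> \<le> \<epsilon> * norm (x - xb) * norm z"
  have "eventually (?P S) (at xb within S)" "eventually (?P T) (at xb within T)"
    using assms e unfolding semismooth_star_set_def by blast+
  then show "eventually (?P (S \<union> T)) (at xb within (S \<union> T))"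
    unfolding at_within_union eventually_sup
    by (auto elim!: eventually_mono
        dest: regular_normal_cone_antimono[OF Un_upper1, THEN subsetD]
          regular_normal_cone_antimono[OF Un_upper2, THEN subsetD])
qed

text \<open>The filter is trivial here. This disposes of pieces that stay away from
  \<open>xb\<close>.\<close>

lemma semismooth_star_set_if_notin_closure:
  "xb \<notin> closure S \<Longrightarrow> semismooth_star_set S xb"
  unfolding semismooth_star_set_def
  by (simp add: not_in_closure_trivial_limitI trivial_limit_eventually)

lemma tangent_cone_curveI:
  fixes \<gamma> :: "real \<Rightarrow> 'a::real_inner"
  assumes deriv: "(\<gamma> has_vector_derivative d) (at 0 within {0..})"
    and S: "\<forall>\<^sub>F t in at_right 0. \<gamma> t \<in> S" and "\<gamma> 0 = x"
  shows "d \<in> tangent_cone S x"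
proof -
  obtain b where b: "b > 0" "\<And>t. 0 < t \<Longrightarrow> t < b \<Longrightarrow> \<gamma> t \<in> S"
    using S unfolding eventually_at_right_field by auto
  \<comment> \<open>The tangent cone asks for membership at every \<open>k\<close>; the offset 2
    keeps \<open>s k\<close> strictly below \<open>b\<close> already at
    \<open>k = 0\<close>.\<close>
  define s where "s = (\<lambda>k. b / real (k + 2))"
  have s: "s k > 0" "s k < b" for k
    using b(1) by (simp_all add: s_def field_simps add_pos_nonneg)
  have s0: "s \<longlonglongrightarrow> 0"
    unfolding s_def using LIMSEQ_ignore_initial_segment[OF lim_const_over_n, of b 2] by simp
  \<comment> \<open>For \<open>t > 0\<close> the norm of \<open>t\<close> is \<open>t\<close>, so
    adding \<open>d\<close> to the remainder quotient of the derivative gives the difference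
    quotient.\<close>
  have "((\<lambda>t. (1 / norm (t - 0)) *\<^sub>R (\<gamma> t - (x + (t - 0) *\<^sub>R d)) + d) \<longlongrightarrow> 0 + d) (at 0 within {0..})"
    using deriv \<open>\<gamma> 0 = x\<close> unfolding has_vector_derivative_def has_derivative_within
    by (intro tendsto_add tendsto_const) simp
  then have "((\<lambda>t. (\<gamma> t - x) /\<^sub>R t) \<longlongrightarrow> d) (at 0 within {0..})"
    unfolding add_0 by (rule Lim_transform_within[OF _ zero_less_one])
      (auto simp: scaleR_diff_right scaleR_add_right divide_inverse)
  moreover have "filterlim s (at 0 within {0..}) sequentially"
    using s0 s(1) less_imp_neq[OF s(1)] by (auto simp: filterlim_at less_imp_le)
  ultimately have "(\<lambda>k. (\<gamma> (s k) - x) /\<^sub>R s k) \<longlonglongrightarrow> d"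
    by (rule filterlim_compose)
  moreover have "x + s k *\<^sub>R ((\<gamma> (s k) - x) /\<^sub>R s k) \<in> S" for k
    using b(2)[OF s] s(1)[of k] by (simp add: less_imp_neq[symmetric])
  ultimately show ?thesis
    unfolding tangent_cone_def using s s0 by blast
qed

lemma regular_normal_orthogonal_line:
  assumes "\<forall>\<^sub>F t in nhds 0. x + t *\<^sub>R d \<in> S" and "z \<in> regular_normal_cone S x"
  shows "z \<bullet> d = 0"
proof -
  have r: "\<forall>\<^sub>F t in at_right 0. x + t *\<^sub>R d \<in> S" and "\<forall>\<^sub>F t in at_left 0. x + t *\<^sub>R d \<in> S"
    unfolding eventually_at_filter by (rule eventually_mono[OF assms(1)], simp)+
  then have l: "\<forall>\<^sub>F t in at_right 0. x + t *\<^sub>R (- d) \<in> S"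
    unfolding eventually_at_left_to_right by simp
  have "d \<in> tangent_cone S x"
    by (rule tangent_cone_curveI[OF _ r]) (auto intro!: derivative_eq_intros)
  moreover have "- d \<in> tangent_cone S x"
    by (rule tangent_cone_curveI[OF _ l]) (auto intro!: derivative_eq_intros)
  ultimately have "z \<bullet> d \<le> 0" "z \<bullet> (- d) \<le> 0"
    using assms(2) unfolding regular_normal_cone_def by blast+
  then show ?thesis by simp
qed

text \<open>The case of no error: the displacement from \<open>xb\<close> can be followed both ways
  along the set, so regular normals annihilate it. Locally conical pieces are of this kind.\<close>

lemma semismooth_star_set_lines:
  assumes "\<forall>\<^sub>F x in at xb within S. \<forall>\<^sub>F t in nhds 0. x + t *\<^sub>R (x - xb) \<in> S"
  shows "semismooth_star_set S xb"
  unfolding semismooth_star_set_def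
proof (intro allI impI)
  fix \<epsilon> :: real assume "\<epsilon> > 0"
  from assms show "\<forall>\<^sub>F x in at xb within S. \<forall>z\<in>regular_normal_cone S x. \<bar>z \<bullet> (x - xb)\<bar>
      \<le> \<epsilon> * norm (x - xb) * norm z"
  proof eventually_elim
    case (elim x)
    show ?case
    proof
      fix z assume "z \<in> regular_normal_cone S x"
      then have "z \<bullet> (x - xb) = 0"
        by (rule regular_normal_orthogonal_line[OF elim])
      then show "\<bar>z \<bullet> (x - xb)\<bar> \<le> \<epsilon> * norm (x - xb) * norm z"
        using \<open>\<epsilon> > 0\<close> by simp
    qed
  qed
qed

text \<open>A regular normal annihilates \<open>d\<close>, since \<open>- d\<close> is tangent too.
  Only \<open>d - (x - xb)\<close> contributes to the pairing, and Cauchy-Schwarz bounds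
  that.\<close>

lemma semismooth_star_set_tangents:
  assumes "\<And>\<epsilon>. \<epsilon> > 0 \<Longrightarrow> \<forall>\<^sub>F x in at xb within S. \<exists>d. d \<in> tangent_cone S x \<and> - d \<in> tangent_cone S x \<and>
      norm (d - (x - xb)) \<le> \<epsilon> * norm (x - xb)"
  shows "semismooth_star_set S xb"
  unfolding semismooth_star_set_def
proof (intro allI impI)
  fix \<epsilon> :: real assume "\<epsilon> > 0"
  have "\<bar>z \<bullet> (x - xb)\<bar> \<le> \<epsilon> * norm (x - xb) * norm z"
    if "z \<in> regular_normal_cone S x" and d: "d \<in> tangent_cone S x" "- d \<in> tangent_cone S x"
      and n: "norm (d - (x - xb)) \<le> \<epsilon> * norm (x - xb)" for x z d
  proof -
    have "z \<bullet> d \<le> 0" "z \<bullet> (- d) \<le> 0"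
      using that unfolding regular_normal_cone_def by blast+
    then have "\<bar>z \<bullet> (x - xb)\<bar> = \<bar>z \<bullet> (d - (x - xb))\<bar>"
      by (simp add: inner_diff_right)
    also have "\<dots> \<le> norm z * (\<epsilon> * norm (x - xb))"
      using Cauchy_Schwarz_ineq2[of z "d - (x - xb)"] mult_left_mono[OF n norm_ge_zero[of z]]
      by linarith
    finally show ?thesis by (simp add: mult.commute)
  qed
  with assms[OF \<open>\<epsilon> > 0\<close>] show "\<forall>\<^sub>F x in at xb within S. \<forall>z\<in>regular_normal_cone S x. \<bar>z \<bullet> (x - xb)\<bar>
      \<le> \<epsilon> * norm (x - xb) * norm z"
    by (auto elim!: eventually_mono)
qed

text \<open>The affine map with linear part \<open>L\<close> that sends \<open>y\<close> to
  \<open>x\<close> carries \<open>T\<close> into \<open>S\<close>; the step sizes stay the same and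
  \<open>L\<close> is applied to the directions.\<close>

lemma tangent_cone_linear_image:
  assumes "bounded_linear L" and "d \<in> tangent_cone T y"
    and S: "\<And>y'. y' \<in> T \<Longrightarrow> x + L (y' - y) \<in> S"
  shows "L d \<in> tangent_cone S x"
proof -
  interpret L: bounded_linear L by fact
  obtain t w where tw: "\<And>k. t k > 0" "t \<longlonglongrightarrow> 0" "w \<longlonglongrightarrow> d" "\<And>k. y + t k *\<^sub>R w k \<in> T"
    using assms(2) unfolding tangent_cone_def by blast
  have "x + t k *\<^sub>R L (w k) \<in> S" for k
    using S[OF tw(4)[of k]] by (simp add: L.scaleR)
  moreover have "(\<lambda>k. L (w k)) \<longlonglongrightarrow> L d"
    by (rule L.tendsto[OF tw(3)])
  ultimately show ?thesis
    unfolding tangent_cone_def using tw(1,2) by blast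
qed

text \<open>\<open>P i\<close> reads off block \<open>i\<close> of a displacement and
  \<open>L i\<close> inserts one. By \<open>repl\<close> a block may be exchanged within
  \<open>T i\<close>, so \<open>adjoint (L i)\<close> maps regular normals of \<open>S\<close> to
  regular normals of \<open>T i\<close>. By \<open>rest\<close> the part of the displacement outside
  the blocks spans a line in \<open>S\<close>, so regular normals annihilate it.\<close>

lemma semismooth_star_set_blocks:
  fixes S :: "'a::euclidean_space set" and T :: "'i \<Rightarrow> 'b::euclidean_space set"
  assumes "finite I"
    and L: "\<And>i. i \<in> I \<Longrightarrow> linear (L i)" and P: "\<And>i. i \<in> I \<Longrightarrow> linear (P i)"
    and T: "\<And>i. i \<in> I \<Longrightarrow> semismooth_star_set (T i) (yb i)"
    and proj: "\<And>i x. i \<in> I \<Longrightarrow> x \<in> S \<Longrightarrow> yb i + P i (x - xb) \<in> T i"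
    and repl: "\<And>i x y. i \<in> I \<Longrightarrow> x \<in> S \<Longrightarrow> y \<in> T i \<Longrightarrow> x + L i (y - (yb i + P i (x - xb))) \<in> S"
    and rest: "\<And>x t. x \<in> S \<Longrightarrow> x + t *\<^sub>R (x - xb - (\<Sum>i\<in>I. L i (P i (x - xb)))) \<in> S"
  shows "semismooth_star_set S xb"
  unfolding semismooth_star_set_def
proof (intro allI impI)
  fix \<epsilon> :: real assume "\<epsilon> > 0"
  define D where "D i = onorm (P i) * onorm (adjoint (L i))" for i
  have blP: "bounded_linear (P i)" and blL: "bounded_linear (L i)"
    and bla: "bounded_linear (adjoint (L i))"
    if "i \<in> I" for i
    using L P that by (auto simp: linear_conv_bounded_linear[symmetric] adjoint_linear)
  have D0: "D i \<ge> 0" if "i \<in> I" for i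
    unfolding D_def using blP bla that by (simp add: onorm_pos_le)
  \<comment> \<open>Shares \<open>\<epsilon>\<close> among the blocks, \<open>D i\<close> being the
    loss from the operator norms; the summand 1 keeps the denominator positive.\<close>
  define \<eta> where "\<eta> = \<epsilon> / (1 + sum D I)"
  have sD: "sum D I \<ge> 0" using D0 by (rule sum_nonneg)
  then have \<eta>: "\<eta> > 0" "\<eta> * sum D I \<le> \<epsilon>"
    using \<open>\<epsilon> > 0\<close> by (auto simp: \<eta>_def field_simps)
  let ?y = "\<lambda>i x. yb i + P i (x - xb)"
  \<comment> \<open>The projection can hit \<open>yb i\<close> although
    \<open>x \<noteq> xb\<close>, so the punctured filter cannot be pulled back directly. The
    condition is moved to \<open>nhds (yb i)\<close> with guards; at \<open>yb i\<close> itself both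
    sides are 0.\<close>
  have ev: "\<forall>\<^sub>F x in at xb within S. \<forall>z\<in>regular_normal_cone (T i) (?y i x).
      \<bar>z \<bullet> (?y i x - yb i)\<bar> \<le> \<eta> * norm (?y i x - yb i) * norm z" if i: "i \<in> I" for i
  proof -
    have "\<forall>\<^sub>F y in nhds (yb i). y \<noteq> yb i \<longrightarrow> y \<in> T i \<longrightarrow> (\<forall>z\<in>regular_normal_cone (T i) y.
      \<bar>z \<bullet> (y - yb i)\<bar> \<le> \<eta> * norm (y - yb i) * norm z)"
      using T[OF i] \<eta>(1) unfolding semismooth_star_set_def eventually_at_filter by blast
    moreover have "(?y i \<longlongrightarrow> ?y i xb) (at xb within S)"
      by (intro tendsto_intros bounded_linear.tendsto[OF blP[OF i]])
    then have "filterlim (?y i) (nhds (yb i)) (at xb within S)"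
      using linear_0[OF P[OF i]] by simp
    ultimately have "\<forall>\<^sub>F x in at xb within S. ?y i x \<noteq> yb i \<longrightarrow> ?y i x \<in> T i \<longrightarrow>
      (\<forall>z\<in>regular_normal_cone (T i) (?y i x). \<bar>z \<bullet> (?y i x - yb i)\<bar>
          \<le> \<eta> * norm (?y i x - yb i) * norm z)"
      unfolding filterlim_iff by blast
    moreover have "\<forall>\<^sub>F x in at xb within S. x \<in> S"
      by (simp add: eventually_at_filter)
    ultimately show ?thesis
      by eventually_elim (use proj[OF i] in \<open>auto\<close>)
  qed
  then have "\<forall>\<^sub>F x in at xb within S. \<forall>i\<in>I. \<forall>z\<in>regular_normal_cone (T i) (?y i x).
      \<bar>z \<bullet> (?y i x - yb i)\<bar> \<le> \<eta> * norm (?y i x - yb i) * norm z"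
    by (intro eventually_ball_finite \<open>finite I\<close>) auto
  moreover have "\<forall>\<^sub>F x in at xb within S. x \<in> S"
    by (simp add: eventually_at_filter)
  ultimately show "\<forall>\<^sub>F x in at xb within S. \<forall>z\<in>regular_normal_cone S x. \<bar>z \<bullet> (x - xb)\<bar>
      \<le> \<epsilon> * norm (x - xb) * norm z"
  proof eventually_elim
    case (elim x)
    show ?case
    proof
      fix z assume z: "z \<in> regular_normal_cone S x"
      let ?w = "x - xb - (\<Sum>i\<in>I. L i (P i (x - xb)))"
      have "z \<bullet> ?w = 0"
        using rest[OF elim(2)] z
        by (intro regular_normal_orthogonal_line[where S = S and x = x]) auto
      then have "z \<bullet> (x - xb) = (\<Sum>i\<in>I. z \<bullet> L i (P i (x - xb)))"
        by (simp add: inner_diff_right inner_sum_right)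
      also have "\<dots> = (\<Sum>i\<in>I. adjoint (L i) z \<bullet> P i (x - xb))"
        by (intro sum.cong refl) (metis adjoint_works[OF L] inner_commute)
      finally have eq: "z \<bullet> (x - xb) = \<dots>" .
      have "\<bar>adjoint (L i) z \<bullet> P i (x - xb)\<bar> \<le> \<eta> * (norm (x - xb) * norm z) * D i" if i: "i \<in> I"
          for i
      proof -
        have "adjoint (L i) z \<bullet> d \<le> 0" if d: "d \<in> tangent_cone (T i) (?y i x)" for d
        proof -
          have "L i d \<in> tangent_cone S x"
            using tangent_cone_linear_image[OF blL[OF i] d] repl[OF i elim(2)] by blast
          then have "z \<bullet> L i d \<le> 0"
            using z unfolding regular_normal_cone_def by blast
          then show ?thesis
            by (metis adjoint_works[OF L[OF i]] inner_commute)
        qed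
        then have "adjoint (L i) z \<in> regular_normal_cone (T i) (?y i x)"
          unfolding regular_normal_cone_def by blast
        then have "\<bar>adjoint (L i) z \<bullet> P i (x - xb)\<bar>
            \<le> \<eta> * norm (P i (x - xb)) * norm (adjoint (L i) z)"
          using elim(1) i by fastforce
        also have "\<dots> \<le> \<eta> * (onorm (P i) * norm (x - xb)) * (onorm (adjoint (L i)) * norm z)"
          using \<eta>(1) onorm[OF blP[OF i], of "x - xb"]
            onorm[OF bla[OF i], of z] onorm_pos_le[OF blP[OF i]]
          by (intro mult_mono mult_nonneg_nonneg) auto
        finally show ?thesis by (simp add: D_def mult_ac)
      qed
      then have "\<bar>z \<bullet> (x - xb)\<bar> \<le> (\<Sum>i\<in>I. \<eta> * (norm (x - xb) * norm z) * D i)"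
        unfolding eq by (intro order_trans[OF sum_abs] sum_mono)
      also have "\<dots> = (\<eta> * (norm (x - xb) * norm z)) * sum D I"
        by (simp add: sum_distrib_left[symmetric])
      also have "\<dots> \<le> \<epsilon> * (norm (x - xb) * norm z)"
        using mult_right_mono[OF \<eta>(2), of "norm (x - xb) * norm z"] by (simp add: mult_ac)
      finally show "\<bar>z \<bullet> (x - xb)\<bar> \<le> \<epsilon> * norm (x - xb) * norm z" by (simp add: mult_ac)
    qed
  qed
qed

section \<open>Coulomb cone\<close>

text \<open>With \<open>v\<close> the tangential displacement, \<open>g\<close> the tangential reaction and \<open>r = - \<F> * \<theta>\<close>, the
  condition \<open>(v, g, r) \<in> coulomb_cone\<close> means \<open>g \<in> r \<partial>norm(v)\<close>, including the case \<open>r = 0\<close>.\<close>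

definition coulomb_cone :: "('a::real_inner \<times> 'a \<times> real) set" where
  "coulomb_cone = {(v, g, r). norm g \<le> r \<and> g \<bullet> v = r * norm v}"

text \<open>Points with \<open>v = 0\<close> and \<open>norm g = r\<close> belong here, which makes
  this piece closed and leaves a strict inequality for \<open>stick_cone\<close>.\<close>

definition slip_cone :: "('a::real_inner \<times> 'a \<times> real) set" where
  "slip_cone = {(v, g, r). norm g = r \<and> g \<bullet> v = r * norm v}"

definition stick_cone :: "('a::real_inner \<times> 'a \<times> real) set" where
  "stick_cone = {(v, g, r). v = 0 \<and> norm g < r}"

text \<open>By Cauchy-Schwarz \<open>r * norm v = g \<bullet> v\<close> is at most
  \<open>norm g * norm v\<close>, which forces \<open>v = 0\<close> when
  \<open>norm g < r\<close>.\<close>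

lemma coulomb_cone_eq: "coulomb_cone = slip_cone \<union> stick_cone"
proof -
  have "v = 0" if "norm g \<le> r" "g \<bullet> v = r * norm v" "norm g \<noteq> r" for v g :: 'a and r
    using norm_cauchy_schwarz[of g v] that by (auto simp: mult_le_cancel_right)
  then show ?thesis
    unfolding coulomb_cone_def slip_cone_def stick_cone_def by force
qed

lemma closed_coulomb_cone: "closed coulomb_cone"
  unfolding coulomb_cone_def case_prod_unfold
  by (intro closed_Collect_conj closed_Collect_le closed_Collect_eq continuous_intros)

lemma closed_slip_cone: "closed slip_cone"
  unfolding slip_cone_def case_prod_unfold
  by (intro closed_Collect_conj closed_Collect_eq continuous_intros)

text \<open>The cone is relatively open in the subspace \<open>v = 0\<close>: if \<open>xb\<close>
  lies in that subspace, short segments along \<open>x - xb\<close> stay in the cone; otherwise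
  \<open>xb\<close> is outside its closure.\<close>

lemma semismooth_stick_cone: "semismooth_star_set stick_cone xb"
proof (cases "fst xb = 0")
  case True
  have "\<forall>\<^sub>F t in nhds 0. x + t *\<^sub>R (x - xb) \<in> stick_cone" if x: "x \<in> stick_cone" for x
  proof -
    have "((\<lambda>t. norm (fst (snd (x + t *\<^sub>R (x - xb)))) - snd (snd (x + t *\<^sub>R (x - xb)))) \<longlongrightarrow>
        norm (fst (snd (x + 0 *\<^sub>R (x - xb)))) - snd (snd (x + 0 *\<^sub>R (x - xb)))) (nhds (0::real))"
      by (intro tendsto_intros filterlim_ident)
    moreover have "norm (fst (snd (x + 0 *\<^sub>R (x - xb)))) - snd (snd (x + 0 *\<^sub>R (x - xb))) < 0"
      using x by (auto simp: stick_cone_def)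
    ultimately have "\<forall>\<^sub>F t in nhds 0. norm (fst (snd (x + t *\<^sub>R (x - xb)))) - snd (snd (x
        + t *\<^sub>R (x - xb))) < 0"
      by (rule order_tendstoD)
    then show ?thesis
      by eventually_elim (use x True in \<open>auto simp: stick_cone_def case_prod_unfold\<close>)
  qed
  then show ?thesis
    by (intro semismooth_star_set_lines) (simp add: eventually_at_filter)
next
  case False
  have "closed {x :: 'a \<times> 'a \<times> real. fst x = 0}"
    by (intro closed_Collect_eq continuous_intros)
  then have "closure stick_cone \<subseteq> {x :: 'a \<times> 'a \<times> real. fst x = 0}"
    by (rule closure_minimal[rotated]) (auto simp: stick_cone_def)
  with False show ?thesis
    by (intro semismooth_star_set_if_notin_closure) auto
qed

text \<open>Moves the polar coordinates \<open>s\<close>, \<open>r\<close>, \<open>\<omega>\<close>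
  with velocities \<open>\<sigma>\<close>, \<open>\<rho>\<close>, \<open>\<tau>\<close>. A radius
  that is 0 must have velocity 0, so that the reversed motion is admissible as well.\<close>

lemma slip_cone_tangent:
  fixes \<omega> \<tau> :: "'a::real_inner"
  assumes \<omega>: "norm \<omega> = 1" and \<tau>: "\<omega> \<bullet> \<tau> = 0"
    and s: "0 < s \<or> s = 0 \<and> \<sigma> = 0" and r: "0 < r \<or> r = 0 \<and> \<rho> = 0"
  shows "(\<sigma> *\<^sub>R \<omega> + s *\<^sub>R \<tau>, \<rho> *\<^sub>R \<omega> + r *\<^sub>R \<tau>, \<rho>) \<in> tangent_cone slip_cone (s *\<^sub>R \<omega>, r *\<^sub>R \<omega>, r)"
proof -
  \<comment> \<open>The direction \<open>\<omega> + t *\<^sub>R \<tau>\<close> is not normalised;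
    its norm \<open>q t\<close> is put into the third component instead. As \<open>q\<close> has
    derivative 0 at 0, the tangent vector is not affected.\<close>
  define q where "q t = sqrt (1 + t\<^sup>2 * (norm \<tau>)\<^sup>2)" for t
  define \<gamma> where "\<gamma> t
      = ((s + t * \<sigma>) *\<^sub>R (\<omega> + t *\<^sub>R \<tau>), (r + t * \<rho>) *\<^sub>R (\<omega> + t *\<^sub>R \<tau>), (r + t * \<rho>) * q t)" for t
  have n: "norm (\<omega> + t *\<^sub>R \<tau>) = q t" for t
  proof -
    have "(norm (\<omega> + t *\<^sub>R \<tau>))\<^sup>2 = 1 + t\<^sup>2 * (norm \<tau>)\<^sup>2"
      using \<omega> \<tau> unfolding power2_norm_eq_inner
      by (simp add: inner_add_left inner_add_right inner_commute[of \<tau> \<omega>] power2_eq_square norm_eq_1)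
    then show ?thesis unfolding q_def by (metis norm_ge_zero real_sqrt_unique)
  qed
  have ev: "\<forall>\<^sub>F t in at_right 0. 0 \<le> a + t * b" if "0 < a \<or> a = 0 \<and> b = 0" for a b :: real
  proof (cases "a = 0")
    case False
    have "((\<lambda>t. a + t * b) \<longlongrightarrow> a + 0 * b) (at_right 0)" by (intro tendsto_intros)
    then have "\<forall>\<^sub>F t in at_right 0. 0 < a + t * b"
      by (rule order_tendstoD) (use False that in simp)
    then show ?thesis by (rule eventually_mono) simp
  qed (use that in simp)
  have S: "\<forall>\<^sub>F t in at_right 0. \<gamma> t \<in> slip_cone"
    using ev[OF s] ev[OF r]
  proof eventually_elim
    case (elim t)
    then show ?case
      by (simp add: \<gamma>_def slip_cone_def n dot_square_norm power2_eq_square)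
  qed
  have q': "(q has_real_derivative 0) (at 0 within {0..})"
    unfolding q_def by (auto intro!: derivative_eq_intros)
  have lin: "((\<lambda>t. (a + t * b) *\<^sub>R (\<omega> + t *\<^sub>R \<tau>)) has_vector_derivative b *\<^sub>R \<omega>
      + a *\<^sub>R \<tau>) (at 0 within {0..})" for a b
    by (auto intro!: derivative_eq_intros)
  have "(\<gamma> has_vector_derivative (\<sigma> *\<^sub>R \<omega> + s *\<^sub>R \<tau>, \<rho> *\<^sub>R \<omega> + r *\<^sub>R \<tau>, \<rho>)) (at 0 within {0..})"
    unfolding \<gamma>_def
  proof (intro has_vector_derivative_Pair lin)
    show "((\<lambda>t. (r + t * \<rho>) * q t) has_vector_derivative \<rho>) (at 0 within {0..})"
      unfolding has_real_derivative_iff_has_vector_derivative[symmetric]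
      by (rule derivative_eq_intros q' | simp add: q_def)+
  qed
  then show ?thesis
    by (rule tangent_cone_curveI[OF _ S]) (simp add: \<gamma>_def q_def)
qed

text \<open>The tangent vector is \<open>x - xb\<close> with the increment of \<open>\<omega>\<close> projected to the tangent space of the
  sphere. The errors are products of increments: \<open>s * norm (\<omega> - \<omega>b)\<close> is itself at most
  \<open>2 * norm (x - xb)\<close>, so no lower bound on \<open>s\<close> or \<open>r\<close> is needed.\<close>

lemma slip_cone_tangent_approx:
  fixes \<omega> \<omega>b :: "'a::real_inner"
  assumes \<omega>: "norm \<omega> = 1" and \<omega>b: "norm \<omega>b = 1"
    and s: "0 < s \<or> s = 0 \<and> sb = 0" and r: "0 < r \<or> r = 0 \<and> rb = 0" and b: "0 \<le> sb" "0 \<le> rb"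
    and x: "x = (s *\<^sub>R \<omega>, r *\<^sub>R \<omega>, r)" and xb: "xb = (sb *\<^sub>R \<omega>b, rb *\<^sub>R \<omega>b, rb)"
  shows "\<exists>d. d \<in> tangent_cone slip_cone x \<and> - d \<in> tangent_cone slip_cone x \<and>
    norm (d - (x - xb)) \<le> 6 * norm (\<omega> - \<omega>b) * norm (x - xb)"
proof -
  define \<Delta> where "\<Delta> = \<omega> - \<omega>b"
  define \<tau> where "\<tau> = \<Delta> - (\<Delta> \<bullet> \<omega>) *\<^sub>R \<omega>"
  have \<tau>: "\<omega> \<bullet> \<tau> = 0"
    using \<omega> by (simp add: \<tau>_def inner_diff_right inner_commute dot_square_norm)
  let ?d = "((s - sb) *\<^sub>R \<omega> + s *\<^sub>R \<tau>, (r - rb) *\<^sub>R \<omega> + r *\<^sub>R \<tau>, r - rb)"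
  have "?d \<in> tangent_cone slip_cone x"
    unfolding x using s r by (intro slip_cone_tangent \<omega> \<tau>) auto
  moreover have "((sb - s) *\<^sub>R \<omega> + s *\<^sub>R (- \<tau>), (rb - r) *\<^sub>R \<omega> + r *\<^sub>R (- \<tau>), rb - r)
      \<in> tangent_cone slip_cone x"
    unfolding x using s r \<tau> by (intro slip_cone_tangent \<omega>) auto
  then have "- ?d \<in> tangent_cone slip_cone x"
    by (simp add: algebra_simps)
  moreover have err: "norm ((a - ab) *\<^sub>R \<omega> + a *\<^sub>R \<tau> - (a *\<^sub>R \<omega> - ab *\<^sub>R \<omega>b))
      \<le> 3 * norm \<Delta> * norm (a *\<^sub>R \<omega> - ab *\<^sub>R \<omega>b)"
    if "0 \<le> a" "0 \<le> ab" for a ab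
  proof -
    let ?n = "norm (a *\<^sub>R \<omega> - ab *\<^sub>R \<omega>b)"
    have a1: "\<bar>a - ab\<bar> \<le> ?n"
      using norm_triangle_ineq3[of "a *\<^sub>R \<omega>" "ab *\<^sub>R \<omega>b"] \<omega> \<omega>b that by simp
    have "a *\<^sub>R \<Delta> = (a *\<^sub>R \<omega> - ab *\<^sub>R \<omega>b) - (a - ab) *\<^sub>R \<omega>b"
      by (simp add: \<Delta>_def algebra_simps)
    then have "norm (a *\<^sub>R \<Delta>) \<le> ?n + norm ((a - ab) *\<^sub>R \<omega>b)"
      by (simp only: norm_triangle_ineq4)
    then have a2: "a * norm \<Delta> \<le> 2 * ?n"
      using a1 \<omega>b that by simp
    \<comment> \<open>Between unit vectors the radial part of the increment is of second
      order.\<close>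
    have "2 * (\<Delta> \<bullet> \<omega>) = (norm \<Delta>)\<^sup>2"
      using \<omega> \<omega>b unfolding \<Delta>_def power2_norm_eq_inner
      by (simp add: inner_diff_left inner_diff_right inner_commute norm_eq_1)
    then have a3: "\<bar>\<Delta> \<bullet> \<omega>\<bar> \<le> norm \<Delta> * norm \<Delta>"
      using zero_le_power2[of "norm \<Delta>"] unfolding power2_eq_square by linarith
    have "(a - ab) *\<^sub>R \<omega> + a *\<^sub>R \<tau> - (a *\<^sub>R \<omega> - ab *\<^sub>R \<omega>b) = (a - ab) *\<^sub>R \<Delta> - (a * (\<Delta> \<bullet> \<omega>)) *\<^sub>R \<omega>"
      by (simp add: \<tau>_def \<Delta>_def algebra_simps)
    then have "norm ((a - ab) *\<^sub>R \<omega> + a *\<^sub>R \<tau> - (a *\<^sub>R \<omega> - ab *\<^sub>R \<omega>b))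
        \<le> norm ((a - ab) *\<^sub>R \<Delta>) + norm ((a * (\<Delta> \<bullet> \<omega>)) *\<^sub>R \<omega>)"
      by (simp only: norm_triangle_ineq4)
    also have "\<dots> = \<bar>a - ab\<bar> * norm \<Delta> + a * \<bar>\<Delta> \<bullet> \<omega>\<bar>"
      using \<omega> that by (simp add: abs_mult)
    also have "\<dots> \<le> ?n * norm \<Delta> + a * (norm \<Delta> * norm \<Delta>)"
      by (intro add_mono mult_right_mono mult_left_mono a1 a3 that norm_ge_zero)
    also have "\<dots> \<le> ?n * norm \<Delta> + 2 * ?n * norm \<Delta>"
      using mult_right_mono[OF a2, of "norm \<Delta>"] by (simp add: mult_ac)
    finally show ?thesis by (simp add: mult_ac)
  qed
  have "norm (?d - (x - xb)) \<le> 6 * norm (\<omega> - \<omega>b) * norm (x - xb)"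
  proof -
    let ?a = "s *\<^sub>R \<omega> - sb *\<^sub>R \<omega>b" and ?b = "r *\<^sub>R \<omega> - rb *\<^sub>R \<omega>b"
    have x': "x - xb = (?a, ?b, r - rb)"
      by (simp add: x xb)
    have "norm ?a \<le> norm (x - xb)" "norm ?b \<le> norm (x - xb)"
      unfolding x' using norm_fst_le norm_snd_le order_trans by blast+
    then have "3 * norm \<Delta> * norm ?a \<le> 3 * norm \<Delta> * norm (x - xb)"
        "3 * norm \<Delta> * norm ?b \<le> 3 * norm \<Delta> * norm (x - xb)"
      by (simp_all add: mult_left_mono)
    \<comment> \<open>The last component of \<open>?d\<close> is exact, and each of the two vector
      components contributes a factor 3.\<close>
    moreover have "norm (?d - (x - xb))
        \<le> norm ((s - sb) *\<^sub>R \<omega> + s *\<^sub>R \<tau> - ?a) + norm ((r - rb) *\<^sub>R \<omega> + r *\<^sub>R \<tau> - ?b)"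
      unfolding x' using norm_Pair_le[of "(s - sb) *\<^sub>R \<omega> + s *\<^sub>R \<tau> - ?a"
          "((r - rb) *\<^sub>R \<omega> + r *\<^sub>R \<tau> - ?b, 0::real)"]
      by (simp add: norm_Pair)
    ultimately show ?thesis
      using err[of s sb] err[of r rb] s r b unfolding \<Delta>_def by linarith
  qed
  ultimately show ?thesis by blast
qed

text \<open>\<open>W\<close> selects the direction \<open>\<omega>\<close>. It is a parameter
  because it must be computed from \<open>v\<close> or from \<open>g\<close>, depending on which is
  nonzero at \<open>xb\<close>. Its continuity makes the factor \<open>6 * norm (W x - W xb)\<close>
  small.\<close>

lemma semismooth_slip_cone_if_polar:
  fixes W :: "'a::real_inner \<times> 'a \<times> real \<Rightarrow> 'a"
  defines "polar x \<equiv> norm (W x) = 1 \<and> x = (norm (fst x) *\<^sub>R W x, snd (snd x) *\<^sub>R W x, snd (snd x))"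
  assumes xb: "xb \<in> slip_cone" and W: "(W \<longlongrightarrow> W xb) (at xb within slip_cone)"
    and polar: "\<forall>\<^sub>F x in at xb within slip_cone. polar x" "polar xb"
  shows "semismooth_star_set slip_cone xb"
proof (rule semismooth_star_set_tangents)
  fix \<epsilon> :: real assume \<epsilon>: "\<epsilon> > 0"
  \<comment> \<open>Supplies the alternatives on \<open>s\<close> and \<open>r\<close> in
    \<open>slip_cone_tangent_approx\<close>: a radius positive at \<open>xb\<close> stays positive
    nearby.\<close>
  have pos: "\<forall>\<^sub>F x in at xb within slip_cone. 0 < f x \<or> f x = 0 \<and> f xb = 0"
    if f: "(f \<longlongrightarrow> f xb) (at xb within slip_cone)" "\<And>x. x \<in> slip_cone \<Longrightarrow> f x \<ge> 0" for f :: "_ \<Rightarrow> real"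
  proof (cases "f xb = 0")
    case True
    then show ?thesis using f(2) by (auto simp: eventually_at_filter less_le)
  next
    case False
    with f(2)[OF xb] have "\<forall>\<^sub>F x in at xb within slip_cone. 0 < f x"
      by (intro order_tendstoD[OF f(1)]) simp
    then show ?thesis by (rule eventually_mono) simp
  qed
  have r0: "snd (snd x) \<ge> 0" if "x \<in> slip_cone" for x :: "'a \<times> 'a \<times> real"
    using that by (auto simp: slip_cone_def)
  have "\<forall>\<^sub>F x in at xb within slip_cone. 0 < norm (fst x) \<or> norm (fst x) = 0 \<and> norm (fst xb) = 0"
    by (rule pos) (auto intro!: tendsto_intros)
  moreover have "\<forall>\<^sub>F x in at xb within slip_cone. 0 < snd (snd x) \<or> snd (snd x) = 0 \<and>
      snd (snd xb) = 0"
    by (rule pos) (auto intro!: tendsto_intros r0)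
  moreover have "\<forall>\<^sub>F x in at xb within slip_cone. dist (W x) (W xb) < \<epsilon> / 6"
    using \<epsilon> by (intro tendstoD[OF W]) simp
  ultimately show "\<forall>\<^sub>F x in at xb within slip_cone. \<exists>d. d \<in> tangent_cone slip_cone x \<and>
      - d \<in> tangent_cone slip_cone x \<and> norm (d - (x - xb)) \<le> \<epsilon> * norm (x - xb)"
    using polar(1)
  proof eventually_elim
    case (elim x)
    have "\<exists>d. d \<in> tangent_cone slip_cone x \<and> - d \<in> tangent_cone slip_cone x \<and>
        norm (d - (x - xb)) \<le> 6 * norm (W x - W xb) * norm (x - xb)"
      using elim polar(2) r0[OF xb] unfolding polar_def
      by (intro slip_cone_tangent_approx[where s = "norm (fst x)" and sb = "norm (fst xb)"
          and r = "snd (snd x)" and rb = "snd (snd xb)"]) auto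
    moreover have "6 * norm (W x - W xb) * norm (x - xb) \<le> \<epsilon> * norm (x - xb)"
      using elim(3) by (intro mult_right_mono) (auto simp: dist_norm)
    ultimately show ?case by (meson order_trans)
  qed
qed

text \<open>At the origin the set is a cone with apex \<open>xb\<close>. Elsewhere a continuous
  direction exists: \<open>g\<close> divided by \<open>r\<close>, or \<open>v\<close> divided by its
  norm.\<close>

lemma semismooth_slip_cone: "semismooth_star_set slip_cone (xb :: 'a::real_inner \<times> 'a \<times> real)"
proof (cases "xb \<in> slip_cone")
  case False
  then show ?thesis
    by (intro semismooth_star_set_if_notin_closure) (simp add: closure_closed[OF closed_slip_cone])
next
  case xb: True
  \<comment> \<open>Equality in Cauchy-Schwarz makes \<open>v\<close> and \<open>g\<close>
    parallel.\<close>
  have par: "norm g *\<^sub>R v = norm v *\<^sub>R g \<and> norm g = r" if "(v, g, r) \<in> slip_cone"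
      for v g :: 'a and r
    using that by (auto simp: slip_cone_def norm_cauchy_schwarz_eq[symmetric])
  have ev: "\<forall>\<^sub>F x in at xb within slip_cone. x \<in> slip_cone"
    by (simp add: eventually_at_filter)
  have "norm (fst (snd xb)) = snd (snd xb)"
    using xb by (auto simp: slip_cone_def)
  then consider "xb = 0" | "snd (snd xb) \<noteq> 0" | "fst xb \<noteq> 0"
    by (fastforce simp: prod_eq_iff)
  then show ?thesis
  proof cases
    case 1
    have "\<forall>\<^sub>F t in nhds 0. x + t *\<^sub>R (x - xb) \<in> slip_cone" if x: "x \<in> slip_cone"
        for x :: "'a \<times> 'a \<times> real"
    proof -
      have "\<forall>\<^sub>F t in nhds 0. -1 < (t :: real)"
        by (rule order_tendstoD[OF filterlim_ident]) simp
      then show ?thesis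
      proof eventually_elim
        case (elim t)
        have "x + t *\<^sub>R (x - xb) = (1 + t) *\<^sub>R x"
          by (simp add: 1 algebra_simps)
        with elim x show ?case by (auto simp: slip_cone_def)
      qed
    qed
    then show ?thesis
      by (intro semismooth_star_set_lines) (simp add: eventually_at_filter)
  next
    case 2
    let ?W = "\<lambda>x :: 'a \<times> 'a \<times> real. fst (snd x) /\<^sub>R snd (snd x)"
    have W: "(?W \<longlongrightarrow> ?W xb) (at xb within slip_cone)"
      using 2 by (intro tendsto_intros)
    have polar: "norm (?W x) = 1 \<and> x = (norm (fst x) *\<^sub>R ?W x, snd (snd x) *\<^sub>R ?W x, snd (snd x))"
      if "x \<in> slip_cone" "snd (snd x) \<noteq> 0" for x
    proof -
      obtain v g r where x: "x = (v, g, r)" by (cases x)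
      have "r *\<^sub>R v = norm v *\<^sub>R g" "norm g = r"
        using par that(1) x by auto
      moreover have "r \<noteq> 0" using that x by simp
      moreover have "v = (r *\<^sub>R v) /\<^sub>R r" using \<open>r \<noteq> 0\<close> by simp
      ultimately show ?thesis unfolding x by (auto simp: mult.commute)
    qed
    have "\<forall>\<^sub>F x in at xb within slip_cone. snd (snd x) \<noteq> 0"
      by (rule tendsto_imp_eventually_ne[OF _ 2]) (intro tendsto_intros)
    with ev have "\<forall>\<^sub>F x in at xb within slip_cone. norm (?W x) = 1 \<and>
        x = (norm (fst x) *\<^sub>R ?W x, snd (snd x) *\<^sub>R ?W x, snd (snd x))"
      by eventually_elim (rule polar)
    then show ?thesis
      by (rule semismooth_slip_cone_if_polar[OF xb W]) (rule polar[OF xb 2])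
  next
    case 3
    let ?W = "\<lambda>x :: 'a \<times> 'a \<times> real. fst x /\<^sub>R norm (fst x)"
    have W: "(?W \<longlongrightarrow> ?W xb) (at xb within slip_cone)"
      using 3 by (intro tendsto_intros) auto
    have polar: "norm (?W x) = 1 \<and> x = (norm (fst x) *\<^sub>R ?W x, snd (snd x) *\<^sub>R ?W x, snd (snd x))"
      if "x \<in> slip_cone" "fst x \<noteq> 0" for x
    proof -
      obtain v g r where x: "x = (v, g, r)" by (cases x)
      have "r *\<^sub>R v = norm v *\<^sub>R g" and "v \<noteq> 0"
        using par that x by auto
      then have "g = (r *\<^sub>R v) /\<^sub>R norm v"
        by simp
      with \<open>v \<noteq> 0\<close> show ?thesis unfolding x by (simp add: mult.commute)
    qed
    have "\<forall>\<^sub>F x in at xb within slip_cone. fst x \<noteq> 0"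
      by (rule tendsto_imp_eventually_ne[OF _ 3]) (intro tendsto_intros)
    with ev have "\<forall>\<^sub>F x in at xb within slip_cone. norm (?W x) = 1 \<and>
        x = (norm (fst x) *\<^sub>R ?W x, snd (snd x) *\<^sub>R ?W x, snd (snd x))"
      by eventually_elim (rule polar)
    then show ?thesis
      by (rule semismooth_slip_cone_if_polar[OF xb W]) (rule polar[OF xb 3])
  qed
qed

lemma semismooth_coulomb_cone: "semismooth_star_set coulomb_cone xb"
  unfolding coulomb_cone_eq
  by (intro semismooth_star_set_Un semismooth_slip_cone semismooth_stick_cone)

section \<open>Graph of one contact block\<close>

text \<open>Testing the subgradient inequality at \<open>v + s\<close> gives
  \<open>norm s \<le> 1\<close>, and at 0 gives \<open>norm v \<le> s \<bullet> v\<close>; the rest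
  is Cauchy-Schwarz.\<close>

lemma subdifferential_norm: "subdifferential norm v = {s. norm s \<le> 1 \<and> s \<bullet> v = norm v}"
proof (intro set_eqI iffI; clarsimp simp: subdifferential_def)
  fix s assume *: "\<forall>y. norm v + s \<bullet> (y - v) \<le> norm y"
  have "s \<bullet> s \<le> norm s"
    using *[rule_format, of "v + s"] norm_triangle_ineq[of v s] by simp
  then have "norm s * norm s \<le> 1 * norm s"
    by (simp add: dot_square_norm power2_eq_square)
  then have n: "norm s \<le> 1"
    by (cases "s = 0") (auto simp: mult_le_cancel_right)
  have "norm v \<le> s \<bullet> v"
    using *[rule_format, of 0] by simp
  moreover have "s \<bullet> v \<le> norm v"
    using norm_cauchy_schwarz[of s v] mult_right_mono[OF n, of "norm v"] by simp
  ultimately show "norm s \<le> 1 \<and> s \<bullet> v = norm v"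
    using n by simp
next
  fix s y assume "norm s \<le> 1" "s \<bullet> v = norm v"
  then show "norm v + s \<bullet> (y - v) \<le> norm y"
    using norm_cauchy_schwarz[of s y] mult_right_mono[of "norm s" 1 "norm y"]
    by (simp add: inner_diff_right)
qed

lemma scaled_subdifferential_norm:
  assumes "r \<ge> 0"
  shows "g \<in> (\<lambda>s. r *\<^sub>R s) ` subdifferential norm v \<longleftrightarrow> (v, g, r) \<in> coulomb_cone"
proof
  assume "g \<in> (\<lambda>s. r *\<^sub>R s) ` subdifferential norm v"
  then show "(v, g, r) \<in> coulomb_cone"
    using assms by (auto simp: subdifferential_norm coulomb_cone_def mult_left_le)
next
  assume *: "(v, g, r) \<in> coulomb_cone"
  show "g \<in> (\<lambda>s. r *\<^sub>R s) ` subdifferential norm v"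
  proof (cases "r = 0")
    case True
    \<comment> \<open>For \<open>r = 0\<close> the image is the zero set only because some
      subgradient exists.\<close>
    have "sgn v \<in> subdifferential norm v"
      by (cases "v = 0") (auto simp: subdifferential_norm sgn_div_norm dot_square_norm
          power2_eq_square norm_sgn)
    moreover have "g = 0" using * True by (simp add: coulomb_cone_def)
    ultimately show ?thesis using True by (intro image_eqI) auto
  next
    case False
    then have "g /\<^sub>R r \<in> subdifferential norm v"
      using * assms by (simp add: subdifferential_norm coulomb_cone_def divide_inverse[symmetric]
          field_simps)
    then show ?thesis using False by (intro image_eqI[of _ _ "g /\<^sub>R r"]) auto
  qed
qed

text \<open>The case \<open>v $ 3 = 0\<close> is included to make the piece closed; it then overlaps
  \<open>contact_part\<close> in contact without reaction.\<close>

definition free_part :: "((real^3) \<times> (real^3)) set" where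
  "free_part = {(v, q). 0 \<le> v $ 3 \<and> q = 0}"

definition contact_part :: "real \<Rightarrow> ((real^3) \<times> (real^3)) set" where
  "contact_part \<F> = {(v, q). v $ 3 = 0 \<and> (tang v, tang q, - (\<F> * q $ 3)) \<in> coulomb_cone}"

lemma convex_normal_cone_halfline:
  "\<theta> \<in> convex_normal_cone {0..} t \<longleftrightarrow> 0 < t \<and> \<theta> = 0 \<or> t = 0 \<and> \<theta> \<le> (0 :: real)"
proof -
  consider "t < 0" | "t = 0" | "t > 0" by linarith
  then show ?thesis
  proof cases
    case 2
    have "\<theta> \<le> 0" if "\<forall>y\<in>{0..}. \<theta> * y \<le> 0"
      using that[rule_format, of 1] by simp
    with 2 show ?thesis
      by (auto simp: convex_normal_cone_def mult_nonpos_nonneg)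
  next
    case 3
    have "\<theta> = 0" if "\<forall>y\<in>{0..}. \<theta> * (y - t) \<le> 0"
      using 3 that[rule_format, of 0] that[rule_format, of "2 * t"]
      by (auto simp: zero_le_mult_iff mult_le_0_iff)
    with 3 show ?thesis
      by (auto simp: convex_normal_cone_def)
  qed (simp add: convex_normal_cone_def)
qed

section \<open>The graph of \<open>Q_tilde\<close> as a union of two pieces\<close>

lemma tang_nth [simp]: "tang v $ 1 = v $ 1" "tang v $ 2 = v $ 2"
  by (simp_all add: tang_def)

lemma Q_tilde_iff:
  "q \<in> Q_tilde \<F> v \<longleftrightarrow> q $ 3 \<in> convex_normal_cone {0..} (v $ 3) \<and>
     tang q \<in> (\<lambda>s. - (\<F> * q $ 3) *\<^sub>R s) ` subdifferential norm (tang v)"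
proof -
  have "q = vector [g $ 1, g $ 2, \<theta>] \<longleftrightarrow> g = tang q \<and> \<theta> = q $ 3" for g :: "real^2" and \<theta>
    by (auto simp: vec_eq_iff forall_3 forall_2)
  then show ?thesis
    unfolding Q_tilde_def by auto
qed

text \<open>For \<open>q $ 3 \<le> 0\<close> the factor in front of the subdifferential is
  nonnegative and the Coulomb cone describes its image. For \<open>q $ 3 > 0\<close> neither side
  holds, as a norm would be bounded by a negative number.\<close>

lemma graph_Q_tilde:
  assumes "\<F> > 0"
  shows "graph_of (Q_tilde \<F>) = free_part \<union> contact_part \<F>"
proof -
  have "q \<in> Q_tilde \<F> v \<longleftrightarrow> 0 \<le> v $ 3 \<and> q = 0 \<or> v $ 3 = 0 \<and> (tang v, tang q, - (\<F> * q $ 3))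
      \<in> coulomb_cone" for v q
  proof (cases "q $ 3 \<le> 0")
    case True
    then have r: "- (\<F> * q $ 3) \<ge> 0"
      using assms by (simp add: mult_nonneg_nonpos)
    have 0: "q = 0 \<longleftrightarrow> q $ 3 = 0 \<and> tang q = 0"
      by (auto simp: vec_eq_iff forall_3 forall_2)
    have "(tang v, tang q, - (\<F> * q $ 3)) \<in> coulomb_cone \<longleftrightarrow> tang q = 0" if "q $ 3 = 0"
      using that by (auto simp: coulomb_cone_def)
    then show ?thesis
      unfolding Q_tilde_iff scaled_subdifferential_norm[OF r] convex_normal_cone_halfline
      using True 0 by auto
  next
    case False
    then have "\<not> norm (tang q) \<le> - (\<F> * q $ 3)"
      using assms mult_pos_pos[of \<F> "q $ 3"] norm_ge_zero[of "tang q"] by linarith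
    with False show ?thesis
      by (auto simp: Q_tilde_iff convex_normal_cone_halfline coulomb_cone_def)
  qed
  then show ?thesis
    by (auto simp: graph_of_def free_part_def contact_part_def)
qed

section \<open>Closedness and semismoothness of the two pieces\<close>

lemma linear_tang: "linear tang"
  by (rule linearI) (auto simp: vec_eq_iff forall_2)

lemma closed_free_part: "closed free_part"
  unfolding free_part_def case_prod_unfold
  by (intro closed_Collect_conj closed_Collect_le closed_Collect_eq continuous_intros)

lemma closed_contact_part: "closed (contact_part \<F>)"
proof -
  have "contact_part \<F> = {x. fst x $ 3 = 0} \<inter>
      (\<lambda>x. (tang (fst x), tang (snd x), - (\<F> * snd x $ 3))) -` coulomb_cone"
    by (auto simp: contact_part_def)
  then show ?thesis
    by (auto intro!: closed_Int closed_Collect_eq closed_vimage closed_coulomb_cone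
        continuous_intros
        bounded_linear.continuous_on[OF linear_tang[unfolded linear_conv_bounded_linear]])
qed

text \<open>The piece is polyhedral. Near \<open>xb\<close> the constraint on \<open>v $ 3\<close>
  is either inactive at \<open>x\<close> or active at both \<open>x\<close> and \<open>xb\<close>,
  so the segment from \<open>xb\<close> extends beyond \<open>x\<close>.\<close>

lemma semismooth_free_part: "semismooth_star_set free_part xb"
proof (cases "xb \<in> free_part")
  case False
  then show ?thesis
    by (intro semismooth_star_set_if_notin_closure) (simp add: closure_closed[OF closed_free_part])
next
  case True
  then have xb: "0 \<le> fst xb $ 3" "snd xb = 0"
    by (auto simp: free_part_def)
  have pos: "\<forall>\<^sub>F x in at xb within free_part. 0 < fst x $ 3 \<or> fst x $ 3 = 0 \<and> fst xb $ 3 = 0"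
  proof (cases "fst xb $ 3 = 0")
    case True
    then show ?thesis
      by (auto simp: eventually_at_filter free_part_def intro!: always_eventually)
  next
    case False
    then have "\<forall>\<^sub>F x in at xb within free_part. 0 < fst x $ 3"
      using xb by (intro order_tendstoD[of _ "fst xb $ 3"] tendsto_intros) auto
    then show ?thesis by (rule eventually_mono) simp
  qed
  have mem: "\<forall>\<^sub>F x in at xb within free_part. x \<in> free_part"
    by (simp add: eventually_at_filter)
  have "\<forall>\<^sub>F x in at xb within free_part. \<forall>\<^sub>F t in nhds 0. x + t *\<^sub>R (x - xb) \<in> free_part"
    using pos mem
  proof eventually_elim
    case (elim x)
    have "((\<lambda>t. fst x $ 3 + t * (fst x $ 3 - fst xb $ 3)) \<longlongrightarrow> fst x $ 3 + 0 * (fst x $ 3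
        - fst xb $ 3)) (nhds 0)"
      by (intro tendsto_intros filterlim_ident)
    then have "\<forall>\<^sub>F t in nhds 0. 0 < fst x $ 3 + t * (fst x $ 3 - fst xb $ 3)" if "0 < fst x $ 3"
      by (rule order_tendstoD) (use that in simp)
    then have "\<forall>\<^sub>F t in nhds 0. 0 \<le> fst x $ 3 + t * (fst x $ 3 - fst xb $ 3)"
      using elim(1) by (auto elim!: eventually_mono)
    then show ?case
      by eventually_elim (use elim(2) xb in \<open>auto simp: free_part_def case_prod_unfold\<close>)
  qed
  then show ?thesis
    by (rule semismooth_star_set_lines)
qed

text \<open>The piece is a linear copy of the Coulomb cone: \<open>P\<close> and \<open>L\<close>
  are inverse to each other on the hyperplane \<open>v $ 3 = 0\<close>. The block lemma is applied
  with a single block and zero remainder.\<close>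

lemma semismooth_contact_part:
  assumes "\<F> > 0"
  shows "semismooth_star_set (contact_part \<F>) xb"
proof (cases "xb \<in> contact_part \<F>")
  case False
  then show ?thesis
    by (intro semismooth_star_set_if_notin_closure)
        (simp add: closure_closed[OF closed_contact_part])
next
  case xb: True
  define P :: "(real^3) \<times> (real^3) \<Rightarrow> (real^2) \<times> (real^2) \<times> real" where
    "P x = (tang (fst x), tang (snd x), - (\<F> * snd x $ 3))" for x
  define L :: "(real^2) \<times> (real^2) \<times> real \<Rightarrow> (real^3) \<times> (real^3)" where
    "L y = (vector [fst y $ 1, fst y $ 2, 0], vector [fst (snd y) $ 1, fst (snd y) $ 2,
        - (snd (snd y) / \<F>)])" for y
  have lin: "linear P" "linear L"
    using assms by (auto intro!: linearI simp: P_def L_def vec_eq_iff forall_2 forall_3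
        algebra_simps add_divide_distrib)
  have PL: "P (L y) = y" for y
    using assms by (cases y) (auto simp: P_def L_def vec_eq_iff forall_2)
  have LP: "L (P x) = x" if "fst x $ 3 = 0" for x
    using assms that by (cases x) (auto simp: P_def L_def vec_eq_iff forall_3)
  have L3: "fst (L y) $ 3 = 0" for y
    by (simp add: L_def)
  have iff: "x \<in> contact_part \<F> \<longleftrightarrow> fst x $ 3 = 0 \<and> P x \<in> coulomb_cone" for x
    by (auto simp: contact_part_def P_def)
  have Pd: "P xb + P (x - xb) = P x" for x
    by (simp add: linear_diff[OF lin(1)])
  show ?thesis
  proof (rule semismooth_star_set_blocks[where I = "{()}" and L = "\<lambda>_. L" and P = "\<lambda>_. P"
        and T = "\<lambda>_. coulomb_cone" and yb = "\<lambda>_. P xb"])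
    show "x + L (y - (P xb + P (x - xb))) \<in> contact_part \<F>"
        if "x \<in> contact_part \<F>" "y \<in> coulomb_cone" for x y
    proof -
      have "P (x + L (y - P x)) = y"
        by (simp add: linear_add[OF lin(1)] PL)
      then show ?thesis
        using that unfolding Pd by (simp add: iff L3)
    qed
    show "x + t *\<^sub>R (x - xb - (\<Sum>i\<in>{()}. L (P (x - xb)))) \<in> contact_part \<F>" if "x \<in> contact_part \<F>"
        for x t
      using that xb LP[of "x - xb"] by (simp add: iff)
  qed (use lin xb in \<open>auto simp: Pd iff semismooth_coulomb_cone\<close>)
qed

lemma semismooth_graph_Q_tilde:
  assumes "\<F> > 0"
  shows "semismooth_star_set (graph_of (Q_tilde \<F>)) xb"
  unfolding graph_Q_tilde[OF assms]
  by (intro semismooth_star_set_Un semismooth_free_part semismooth_contact_part assms)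

lemma closed_graph_Q_tilde: "\<F> > 0 \<Longrightarrow> closed (graph_of (Q_tilde \<F>))"
  by (simp add: graph_Q_tilde closed_Un closed_free_part closed_contact_part)

section \<open>Graph of the contact mapping\<close>

definition embed_block :: "(nat \<Rightarrow> 'n::finite) \<Rightarrow> nat \<Rightarrow> real^3 \<Rightarrow> real^'n" where
  "embed_block e i v = (\<chi> j. if j = e (3 * i - 2) then v $ 1 else if j = e (3 * i - 1) then v $ 2
     else if j = e (3 * i) then v $ 3 else 0)"

lemma linear_block: "linear (block e i)"
  by (rule linearI) (auto simp: block_def vec_eq_iff forall_3)

lemma linear_embed: "linear (embed_block e i)"
  by (rule linearI) (auto simp: embed_block_def vec_eq_iff)

lemma graph_H_map:
  fixes A :: "real^'n^'n"
  shows "graph_of (H_map e p \<F> A l) = {(u, y). y - A *v u + l \<in> Q_map e p \<F> u}"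
proof -
  have "y = A *v u - l + q \<longleftrightarrow> q = y - A *v u + l" for u y q :: "real^'n"
    by (auto simp: algebra_simps)
  then show ?thesis
    unfolding graph_of_def H_map_def by auto
qed

section \<open>Block coordinates under a numbering of the components\<close>

context
  fixes e :: "nat \<Rightarrow> 'n::finite" and p :: nat
  assumes e: "bij_betw e {1..CARD('n)} UNIV" and p: "3 * p \<le> CARD('n)"
begin

lemma index_eq_iff: "a \<in> {1..CARD('n)} \<Longrightarrow> b \<in> {1..CARD('n)} \<Longrightarrow> e a = e b \<longleftrightarrow> a = b"
  using bij_betw_imp_inj_on[OF e] by (rule inj_on_eq_iff)

lemma block_embed:
  assumes "i \<in> {1..p}" "j \<in> {1..p}"
  shows "block e j (embed_block e i v) = (if i = j then v else 0)"
proof -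
  \<comment> \<open>For positive block numbers the subtraction does not truncate, and
    \<open>3 * i - a\<close> with \<open>a < 3\<close> determines \<open>i\<close> and
    \<open>a\<close>.\<close>
  have "e (3 * j - a) = e (3 * i - b) \<longleftrightarrow> i = j \<and> a = b" if "a < 3" "b < 3" for a b
  proof -
    have "e (3 * j - a) = e (3 * i - b) \<longleftrightarrow> 3 * j - a = 3 * i - b"
      using assms p that by (intro index_eq_iff) auto
    also have "\<dots> \<longleftrightarrow> i = j \<and> a = b"
      using assms that by auto presburger+
    finally show ?thesis .
  qed
  note * = this[of 0 0, simplified] this[of 0 1, simplified] this[of 0 2, simplified]
    this[of 1 0, simplified] this[of 1 1, simplified] this[of 1 2, simplified]
    this[of 2 0, simplified] this[of 2 1, simplified] this[of 2 2, simplified]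
  show ?thesis
    by (auto simp: block_def embed_block_def vec_eq_iff forall_3 *)
qed

lemma embed_nth_rest:
  assumes "i \<in> {1..p}" "j \<in> {3 * p + 1..CARD('n)}"
  shows "embed_block e i v $ e j = 0"
proof -
  have "e j \<noteq> e (3 * i - a)" if "a < 3" for a
    using assms p that by (subst index_eq_iff) auto
  from this[of 0] this[of 1] this[of 2] show ?thesis
    by (simp add: embed_block_def)
qed

lemma vec_eq_0_by_blocks:
  fixes q :: "real^'n"
  assumes "\<And>i. i \<in> {1..p} \<Longrightarrow> block e i q = 0" "\<And>j. j \<in> {3 * p + 1..CARD('n)} \<Longrightarrow> q $ e j = 0"
  shows "q = 0"
proof (rule vec_eq_iff[THEN iffD2], rule allI)
  fix x
  obtain j where j: "j \<in> {1..CARD('n)}" "x = e j"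
    using e unfolding bij_betw_def by blast
  show "q $ x = 0 $ x"
  proof (cases "j \<le> 3 * p")
    case True
    \<comment> \<open>The number of the block containing component \<open>j\<close>: a third of
      \<open>j\<close>, rounded up.\<close>
    define i where "i = (j + 2) div 3"
    have i: "i \<in> {1..p}" and "j = 3 * i - 2 \<or> j = 3 * i - 1 \<or> j = 3 * i"
      using j(1) True unfolding i_def by auto
    moreover have "q $ e (3 * i - 2) = 0" "q $ e (3 * i - 1) = 0" "q $ e (3 * i) = 0"
      using assms(1)[OF i] by (auto simp: block_def vec_eq_iff forall_3)
    ultimately show ?thesis using j(2) by auto
  qed (use assms(2)[of j] j in auto)
qed

lemma closed_graph_H_map:
  assumes "\<F> > 0"
  shows "closed (graph_of (H_map e p \<F> A l))"
proof -
  define q where "q x = snd x - A *v fst x + l" for x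
  have q: "continuous_on UNIV q"
    unfolding q_def
    by (intro continuous_intros linear_continuous_on_compose[OF _ matrix_vector_mul_linear])
  have "graph_of (H_map e p \<F> A l) =
      (\<Inter>i\<in>{1..p}. (\<lambda>x. (block e i (fst x), block e i (q x))) -` graph_of (Q_tilde \<F>)) \<inter>
      (\<Inter>j\<in>{3 * p + 1..CARD('n)}. {x. q x $ e j = 0})"
    unfolding graph_H_map by (auto simp: Q_map_def q_def graph_of_def)
  then show ?thesis
    by (auto intro!: closed_Int closed_INT closed_vimage closed_graph_Q_tilde assms
        closed_Collect_eq
        continuous_intros q linear_continuous_on_compose[OF _ linear_block])
qed

text \<open>In the coordinates \<open>u\<close> and \<open>q = y - A *v u + l\<close> the graph is a
  product of block graphs with a free part in \<open>u\<close> and a zero part in \<open>q\<close>,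
  which is the setting of the block lemma.\<close>

lemma semismooth_graph_H_map:
  assumes "\<F> > 0" and xb: "xb \<in> graph_of (H_map e p \<F> A l)"
  shows "semismooth_star_set (graph_of (H_map e p \<F> A l)) xb"
proof -
  define q where "q x = snd x - A *v fst x + l" for x
  \<comment> \<open>\<open>P\<close> acts on displacements, so \<open>l\<close> cancels. The term
    with \<open>A\<close> in \<open>L\<close> is chosen so that inserting a block changes
    \<open>q\<close> in that block only.\<close>
  define P where "P i x = (block e i (fst x), block e i (snd x - A *v fst x))" for i x
  define L where "L i y
      = (embed_block e i (fst y), A *v embed_block e i (fst y) + embed_block e i (snd y))" for i y
  define yb where "yb i = (block e i (fst xb), block e i (q xb))" for i
  note lin = linear_add[OF linear_block] linear_diff[OF linear_block] linear_cmul[OF linear_block]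
      linear_0[OF linear_block]
    linear_add[OF linear_embed] linear_cmul[OF linear_embed]
  have graph: "x \<in> graph_of (H_map e p \<F> A l) \<longleftrightarrow>
      (\<forall>i\<in>{1..p}. (block e i (fst x), block e i (q x)) \<in> graph_of (Q_tilde \<F>)) \<and>
      (\<forall>j\<in>{3 * p + 1..CARD('n)}. q x $ e j = 0)" for x
    unfolding graph_H_map by (auto simp: Q_map_def q_def graph_of_def)
  have shift: "yb i + P i (x - xb) = (block e i (fst x), block e i (q x))" for i x
    by (simp add: yb_def P_def q_def lin matrix_vector_mult_diff_distrib)
  show ?thesis
  proof (rule semismooth_star_set_blocks[where I = "{1..p}" and L = L and P = P
        and T = "\<lambda>_. graph_of (Q_tilde \<F>)" and yb = yb])
    show "linear (P i)" "linear (L i)" for i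
      by (auto intro!: linearI simp: P_def L_def lin matrix_vector_mult_diff_distrib
          matrix_vector_right_distrib
          matrix_vector_mult_scaleR scaleR_diff_right scaleR_add_right algebra_simps)
    show "x + L i (y - (yb i + P i (x - xb))) \<in> graph_of (H_map e p \<F> A l)"
      if i: "i \<in> {1..p}" and x: "x \<in> graph_of (H_map e p \<F> A l)" and y: "y \<in> graph_of (Q_tilde \<F>)"
          for i x y
    proof -
      let ?a = "fst y - block e i (fst x)" and ?b = "snd y - block e i (q x)"
      let ?x = "x + L i (y - (block e i (fst x), block e i (q x)))"
      have "fst ?x = fst x + embed_block e i ?a" "q ?x = q x + embed_block e i ?b"
        by (simp_all add: L_def q_def matrix_vector_right_distrib)
      then show ?thesis
        unfolding shift using x y i
        by (auto simp: graph lin block_embed embed_nth_rest)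
    qed
    show "x + t *\<^sub>R (x - xb - (\<Sum>i\<in>{1..p}. L i (P i (x - xb)))) \<in> graph_of (H_map e p \<F> A l)"
      if x: "x \<in> graph_of (H_map e p \<F> A l)" for x t
    proof -
      \<comment> \<open>The components numbered above \<open>3 * p\<close>. Those of
        \<open>q\<close> vanish on the graph, so only \<open>u\<close> leaves a remainder.\<close>
      define rem where "rem w = w - (\<Sum>i\<in>{1..p}. embed_block e i (block e i w))" for w
      have block_rem: "block e j (rem w) = 0" if "j \<in> {1..p}" for j w
        using that by (simp add: rem_def lin linear_sum[OF linear_block] block_embed if_distrib
            cong: if_cong)
      let ?u = "fst x - fst xb"
      have "rem (q x - q xb) = 0"
      proof (rule vec_eq_0_by_blocks)
        show "rem (q x - q xb) $ e j = 0" if "j \<in> {3 * p + 1..CARD('n)}" for j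
          using that x xb by (simp add: rem_def graph embed_nth_rest)
      qed (rule block_rem)
      then have d: "(\<Sum>i\<in>{1..p}. embed_block e i (block e i (q x - q xb))) = q x - q xb"
        by (simp add: rem_def)
      have "P i (x - xb) = (block e i ?u, block e i (q x - q xb))" for i
        by (simp add: P_def q_def matrix_vector_mult_diff_distrib algebra_simps)
      then have "(\<Sum>i\<in>{1..p}. L i (P i (x - xb))) =
          (\<Sum>i\<in>{1..p}. (embed_block e i (block e i ?u), A *v embed_block e i (block e i ?u)
              + embed_block e i (block e i (q x - q xb))))"
        by (simp only: L_def fst_conv snd_conv)
      also have "\<dots> = (?u - rem ?u, A *v (?u - rem ?u) + (q x - q xb))"
        by (simp only: sum_prod sum.distrib d linear_sum[OF matrix_vector_mul_linear, symmetric])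
          (simp add: rem_def)
      finally have w: "x - xb - (\<Sum>i\<in>{1..p}. L i (P i (x - xb))) = (rem ?u, A *v rem ?u)"
        by (simp add: prod_eq_iff q_def matrix_vector_mult_diff_distrib)
      \<comment> \<open>Along this line neither \<open>q\<close> nor any block of \<open>u\<close>
        changes, so it stays in the graph for every \<open>t\<close>.\<close>
      let ?x = "x + t *\<^sub>R (rem ?u, A *v rem ?u)"
      have "fst ?x = fst x + t *\<^sub>R rem ?u" "q ?x = q x"
        by (simp_all add: q_def matrix_vector_right_distrib matrix_vector_mult_scaleR)
      then show ?thesis
        unfolding w using x by (simp add: graph lin block_rem)
    qed
  qed (use assms(1) xb in \<open>auto simp: shift graph semismooth_graph_Q_tilde\<close>)
qed

end

theorem proposition6p3:
  fixes A :: "real^'n^'n" and l :: "real^'n" and \<F> :: real and p :: nat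
    and e :: "nat \<Rightarrow> 'n"
  assumes "p \<ge> 1" and "CARD('n) \<ge> 3 * p"
    and "bij_betw e {1..CARD('n)} UNIV"
    and "positive_definite A"
    and "\<F> > 0"
  shows "\<forall>(u, y) \<in> graph_of (H_map e p \<F> A l). semismooth_star_at (H_map e p \<F> A l) u y"
  using assms by (auto intro!: semismooth_star_at_if_set closed_graph_H_map semismooth_graph_H_map)

end
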